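(* Let $\widetilde F^k$ be the L-SARAH estimator (see context) and $\bar{\mathcal E}_k:=\mathbb{E}_\xi[\|\mathbf F(x^k,\xi)-\mathbf F(x^{k-1},\xi)\|^2]$. Then $$\mathbb{E}_k[\|\widetilde F^k-Fx^k\|^2]\le(1-\mathbf p_k)\|\widetilde F^{k-1}-Fx^{k-1}\|^2+\mathbf p_k\,\mathbb{E}_k[\|\bar Fx^k-Fx^k\|^2]+\frac{1-\mathbf p_k}{b_k}\,\bar{\mathcal E}_k.$$ Consequently, $\widetilde F^k$ satisfies the $\mathbf{VR}(\Delta_k;\kappa_k,\Theta_k,\sigma_k)$ property (see context) with $\Delta_k:=\|\widetilde F^k-Fx^k\|^2$, $\kappa_k:=\mathbf p_k$, $\Theta_k:=\frac1{b_k}$, and $\sigma_k^2:=\frac{\mathbf p_k\sigma^2}{n_k}$. In particular, if $\bar Fx^k:=Fx^k$, then $\widetilde F^k$ satisfies the $\mathbf{VR}$ property with the same $\Delta_k$, $\kappa_k$ and $\Theta_k$, but with $\sigma_k=0$.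
   Context: Setting: $F:\mathbb{R}^p\to\mathbb{R}^p$ with either $Fx=\frac1n\sum_{i=1}^nF_ix$ (finite-sum setting; then $\mathbf F(x,\xi)$ means $F_ix$ with $i$ uniform on $\{1,\dots,n\}$) or $Fx=\mathbb{E}_\xi[\mathbf F(x,\xi)]$ (expectation setting), where $\mathbb{E}_\xi[\|\mathbf F(x,\xi)-Fx\|^2]\le\sigma^2$ for all $x\in\mathrm{dom}(F)$. $\{x^k\}_{k\ge0}$ is a given sequence of iterates (with $x^{-1}:=x^0$). $\mathcal F_k$ is the $\sigma$-algebra generated by all randomness up to the current iterates $x^0,\dots,x^k$, including all draws of iterations before $k$ (but not the random draws made at iteration $k$, which are made independently given $\mathcal F_k$); $\mathbb{E}_k[\cdot]=\mathbb{E}[\cdot\mid\mathcal F_k]$. In $\mathbb{E}_\xi$, $\xi$ is a fresh copy independent of everything else. L-SARAH (loopless SARAH) estimator: $\widetilde F^0:=\bar Fx^0$ and then, with an i.i.d. sample $\mathcal S_k$ of size $b_k$ and $\mathbf F(\cdot,\mathcal S_k):=\frac1{b_k}\sum_{\xi_i\in\mathcal S_k}\mathbf F(\cdot,\xi_i)$: $\widetilde F^k:=\widetilde F^{k-1}+\mathbf F(x^k,\mathcal S_k)-\mathbf F(x^{k-1},\mathcal S_k)$ with probability $1-\mathbf p_k$, and $\widetilde F^k:=\bar Fx^k$ with probability $\mathbf p_k$, where $\mathbf p_k\in[\underline{\mathbf p},1)$, $\underline{\mathbf p}>0$. The quantity $\bar Fx^k$ is either the full-batch evaluation $Fx^k$,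 or a mega-batch evaluation $\frac1{n_k}\sum_{\xi\in\bar{\mathcal S}_k}\mathbf F(x^k,\xi)$ with a mega-batch $\bar{\mathcal S}_k$ of size $n_k$, for which $\mathbb{E}_{\bar{\mathcal S}_k}[\bar Fx^k]=Fx^k$ and $\mathbb{E}_{\bar{\mathcal S}_k}[\|\bar Fx^k-Fx^k\|^2]\le\sigma^2/n_k$. $\mathbf{VR}(\Delta_k;\kappa_k,\Theta_k,\sigma_k)$ property, for parameters $\kappa_k\in(0,1]$, $\Theta_k\ge0$, $\sigma_k\ge0$ and a random quantity $\Delta_k\ge0$: almost surely, for all $k\ge0$, $\mathbb{E}_k[\|\widetilde F^k-Fx^k\|^2]\le\mathbb{E}_k[\Delta_k]$ and $\mathbb{E}_k[\Delta_k]\le(1-\kappa_k)\Delta_{k-1}+\Theta_k\bar{\mathcal E}_k+\sigma_k^2$, where $x^{-1}:=x^0$ and $\Delta_{-1}:=0$.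
   Formalization: The first inequality is stated for k ≥ 1, and for a mega-batch start σ_0² is σ²/n_0 instead of p_0σ²/n_0, since F̃^0 equals the mega-batch evaluation with certainty and the literal value at k = 0 is too small (it fails when the variance is exactly σ² > 0). *)

theory Defs
  imports "HOL-Probability.Probability"
begin

text \<open>
  The law of the sample \<open>\<xi>\<close> is a probability measure \<open>D\<close>, and \<open>BF y \<xi>\<close> is the stochastic oracle for
  \<open>F y\<close>. In the finite-sum setting the summands are indexed by a finite set \<open>I\<close> and \<open>D\<close> is
  uniform on \<open>I\<close>.
\<close>

definition finite_sum_setting ::
    "'s measure \<Rightarrow> (real ^ 'p \<Rightarrow> 's \<Rightarrow> real ^ 'p) \<Rightarrow> (real ^ 'p \<Rightarrow> real ^ 'p) \<Rightarrow> bool" where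
  "finite_sum_setting D BF F \<longleftrightarrow>
     (\<exists>I. finite I \<and> I \<noteq> {} \<and> D = uniform_count_measure I \<and>
          (\<forall>y. F y = (1 / real (card I)) *\<^sub>R (\<Sum>i\<in>I. BF y i)))"

definition expectation_setting ::
    "'s measure \<Rightarrow> (real ^ 'p \<Rightarrow> 's \<Rightarrow> real ^ 'p) \<Rightarrow> (real ^ 'p \<Rightarrow> real ^ 'p) \<Rightarrow> real \<Rightarrow> bool" where
  "expectation_setting D BF F \<sigma> \<longleftrightarrow>
     (\<forall>y. integrable D (BF y) \<and> F y = (\<integral>\<xi>. BF y \<xi> \<partial>D) \<and>
          (\<integral>\<^sup>+\<xi>. ennreal ((norm (BF y \<xi> - F y))\<^sup>2) \<partial>D) \<le> ennreal (\<sigma>\<^sup>2))"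

definition batch_mean ::
    "(real ^ 'p \<Rightarrow> 's \<Rightarrow> real ^ 'p) \<Rightarrow> nat \<Rightarrow> (nat \<Rightarrow> 's) \<Rightarrow> real ^ 'p \<Rightarrow> real ^ 'p" where
  "batch_mean BF m s y = (1 / real m) *\<^sub>R (\<Sum>i<m. BF y (s i))"

text \<open>
  Truncated subtraction on \<open>nat\<close> implements the convention \<open>x\<^sup>-\<^sup>1 = x\<^sup>0\<close>: at \<open>k = 0\<close>
  the following quantity is \<open>0\<close>.
\<close>

definition Ebar ::
    "'s measure \<Rightarrow> (real ^ 'p \<Rightarrow> 's \<Rightarrow> real ^ 'p) \<Rightarrow> (nat \<Rightarrow> 'w \<Rightarrow> real ^ 'p) \<Rightarrow> nat \<Rightarrow> 'w \<Rightarrow> ennreal" where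
  "Ebar D BF x k \<omega> = (\<integral>\<^sup>+\<xi>. ennreal ((norm (BF (x k \<omega>) \<xi> - BF (x (k - 1) \<omega>) \<xi>))\<^sup>2) \<partial>D)"

text \<open>
  All conditional expectations are of nonnegative random variables, so they are taken in
  \<open>[0, \<infinity>]\<close>; no integrability is presupposed.
\<close>

abbreviation cond_E :: "'w measure \<Rightarrow> (nat \<Rightarrow> 'w measure) \<Rightarrow> nat \<Rightarrow> ('w \<Rightarrow> real) \<Rightarrow> 'w \<Rightarrow> ennreal" where
  "cond_E M Fil k f \<equiv> nn_cond_exp M (Fil k) (\<lambda>\<omega>. ennreal (f \<omega>))"

text \<open>
  \<open>nn_cond_exp\<close> is \<open>0\<close> on non-measurable functions, hence the explicit measurability clauses.
\<close>

definition VR_property ::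
    "'w measure \<Rightarrow> (nat \<Rightarrow> 'w measure) \<Rightarrow> 's measure \<Rightarrow> (real ^ 'p \<Rightarrow> 's \<Rightarrow> real ^ 'p) \<Rightarrow>
     (real ^ 'p \<Rightarrow> real ^ 'p) \<Rightarrow> (nat \<Rightarrow> 'w \<Rightarrow> real ^ 'p) \<Rightarrow> (nat \<Rightarrow> 'w \<Rightarrow> real ^ 'p) \<Rightarrow>
     (nat \<Rightarrow> 'w \<Rightarrow> real) \<Rightarrow> (nat \<Rightarrow> real) \<Rightarrow> (nat \<Rightarrow> real) \<Rightarrow> (nat \<Rightarrow> real) \<Rightarrow> bool" where
  "VR_property M Fil D BF F x Ft \<Delta> \<kappa> \<Theta> \<sigma> \<longleftrightarrow>
     (\<forall>k. 0 < \<kappa> k \<and> \<kappa> k \<le> 1 \<and> 0 \<le> \<Theta> k \<and> 0 \<le> \<sigma> k) \<and>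
     (\<forall>k. \<Delta> k \<in> borel_measurable M \<and> (\<forall>\<omega>\<in>space M. 0 \<le> \<Delta> k \<omega>)) \<and>
     (\<forall>k. (\<lambda>\<omega>. Ft k \<omega> - F (x k \<omega>)) \<in> borel_measurable M) \<and>
     (AE \<omega> in M. \<forall>k.
        cond_E M Fil k (\<lambda>\<omega>. (norm (Ft k \<omega> - F (x k \<omega>)))\<^sup>2) \<omega> \<le> cond_E M Fil k (\<Delta> k) \<omega> \<and>
        cond_E M Fil k (\<Delta> k) \<omega>
          \<le> ennreal ((1 - \<kappa> k) * (if k = 0 then 0 else \<Delta> (k - 1) \<omega>))
             + ennreal (\<Theta> k) * Ebar D BF x k \<omega> + ennreal ((\<sigma> k)\<^sup>2))"

text \<open>
  Labels for the sources of randomness that are independent at one iteration: the past, the coin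
  that decides about restarting, the single samples of the mini-batch, and the mega-batch as a
  whole (whose entries need not be independent of each other).
\<close>

datatype source = Past | Coin | Sample nat | Mega

text \<open>
  \<open>Fil k\<close> is the \<open>\<sigma>\<close>-algebra of the information available before the draws of iteration \<open>k\<close>;
  it may contain further randomness of the algorithm producing the iterates. At iteration \<open>k\<close>
  the draws are \<open>coin k\<close> (restart or not), the mini-batch \<open>S k 0, \<dots>, S k (b k - 1)\<close> and
  the mega-batch \<open>Z k 0, \<dots>, Z k (n k - 1)\<close>. The flag \<open>full k\<close> says that \<open>Fbar k\<close> is the
  full-batch evaluation; the mega-batch is then irrelevant. The coin and mini-batch
  of iteration \<open>0\<close> are irrelevant too, so their laws are not prescribed.
\<close>

locale l_sarah = prob_space M
  for M :: "'w measure" +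
  fixes Fil :: "nat \<Rightarrow> 'w measure"
    and D :: "'s measure"
    and BF :: "real ^ 'p \<Rightarrow> 's \<Rightarrow> real ^ 'p"
    and F :: "real ^ 'p \<Rightarrow> real ^ 'p"
    and \<sigma> :: real
    and x :: "nat \<Rightarrow> 'w \<Rightarrow> real ^ 'p"
    and p_low :: real
    and p :: "nat \<Rightarrow> real"
    and b n :: "nat \<Rightarrow> nat"
    and full :: "nat \<Rightarrow> bool"
    and coin :: "nat \<Rightarrow> 'w \<Rightarrow> bool"
    and S Z :: "nat \<Rightarrow> nat \<Rightarrow> 'w \<Rightarrow> 's"
    and Fbar Ft :: "nat \<Rightarrow> 'w \<Rightarrow> real ^ 'p"
  assumes sample_law: "prob_space D"
    and oracle_measurable: "(\<lambda>(y, \<xi>). BF y \<xi>) \<in> borel_measurable (borel \<Otimes>\<^sub>M D)"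
    and sigma_nonneg: "0 \<le> \<sigma>"
    and setting: "finite_sum_setting D BF F \<or> expectation_setting D BF F \<sigma>"
    and p_low_pos: "0 < p_low"
    and p_range: "\<And>k. p_low \<le> p k \<and> p k < 1"
    and batch_sizes: "\<And>k. 1 \<le> b k \<and> 1 \<le> n k"
    and Fil_filtration: "filtration (space M) Fil"
    and Fil_subalgebra: "\<And>k. subalgebra M (Fil k)"
    and iterate_measurable: "\<And>k. x k \<in> borel_measurable (Fil k)"
    and coin_measurable: "\<And>k. coin k \<in> measurable (Fil (Suc k)) (count_space UNIV)"
    and S_measurable: "\<And>k i. i < b k \<Longrightarrow> S k i \<in> measurable (Fil (Suc k)) D"
    and Z_measurable: "\<And>k i. i < n k \<Longrightarrow> Z k i \<in> measurable (Fil (Suc k)) D"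
    and draws_indep: "\<And>k. indep_sets
          (\<lambda>r. case r of
              Past \<Rightarrow> sets (Fil k)
            | Coin \<Rightarrow> sets (vimage_algebra (space M) (coin k) (count_space UNIV))
            | Sample i \<Rightarrow> sets (vimage_algebra (space M) (S k i) D)
            | Mega \<Rightarrow> sets (vimage_algebra (space M) (\<lambda>\<omega>. \<lambda>i\<in>{..<n k}. Z k i \<omega>)
                                (Pi\<^sub>M {..<n k} (\<lambda>_. D))))
          ({Past, Coin, Mega} \<union> Sample ` {..<b k})"
    and coin_law: "\<And>k. 1 \<le> k \<Longrightarrow> prob {\<omega> \<in> space M. coin k \<omega>} = p k"
    and S_law: "\<And>k i. 1 \<le> k \<Longrightarrow> i < b k \<Longrightarrow> distr M D (S k i) = D"
    and mega_unbiased: "\<And>k y. \<not> full k \<Longrightarrow>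
          integrable M (\<lambda>\<omega>. batch_mean BF (n k) (\<lambda>i. Z k i \<omega>) y) \<and>
          expectation (\<lambda>\<omega>. batch_mean BF (n k) (\<lambda>i. Z k i \<omega>) y) = F y"
    and mega_variance: "\<And>k y. \<not> full k \<Longrightarrow>
          (\<integral>\<^sup>+\<omega>. ennreal ((norm (batch_mean BF (n k) (\<lambda>i. Z k i \<omega>) y - F y))\<^sup>2) \<partial>M)
            \<le> ennreal (\<sigma>\<^sup>2 / real (n k))"
    and Fbar_eq: "\<And>k \<omega>. \<omega> \<in> space M \<Longrightarrow>
          Fbar k \<omega> = (if full k then F (x k \<omega>)
                      else batch_mean BF (n k) (\<lambda>i. Z k i \<omega>) (x k \<omega>))"
    and Ft_0: "\<And>\<omega>. \<omega> \<in> space M \<Longrightarrow> Ft 0 \<omega> = Fbar 0 \<omega>"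
    and Ft_Suc: "\<And>k \<omega>. \<omega> \<in> space M \<Longrightarrow>
          Ft (Suc k) \<omega> =
            (if coin (Suc k) \<omega> then Fbar (Suc k) \<omega>
             else Ft k \<omega> + batch_mean BF (b (Suc k)) (\<lambda>i. S (Suc k) i \<omega>) (x (Suc k) \<omega>)
                         - batch_mean BF (b (Suc k)) (\<lambda>i. S (Suc k) i \<omega>) (x k \<omega>))"

text \<open>
  At \<open>k = 0\<close> the estimator equals \<open>Fbar 0\<close> with probability one, not with probability \<open>p 0\<close>.
  For a mega-batch start the variance term is therefore \<open>\<sigma>\<^sup>2 / n 0\<close>; the value \<open>p 0 * \<sigma>\<^sup>2 / n 0\<close>
  would be too small, as \<open>p 0 < 1\<close>. A full-batch start has no error, and the generic value is kept.
\<close>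

definition lsarah_sigma ::
    "real \<Rightarrow> (nat \<Rightarrow> real) \<Rightarrow> (nat \<Rightarrow> nat) \<Rightarrow> (nat \<Rightarrow> bool) \<Rightarrow> nat \<Rightarrow> real" where
  "lsarah_sigma \<sigma> p n full k =
     (if k = 0 \<and> \<not> full 0 then sqrt (\<sigma>\<^sup>2 / real (n 0)) else sqrt (p k * \<sigma>\<^sup>2 / real (n k)))"

end

theory Submission
  imports Defs
begin

text \<open>
  At iteration \<open>k \<ge> 1\<close>, fix everything that happened before the draws. The iterates
  \<open>y = x k\<close> and \<open>y' = x (k - 1)\<close> and the previous error \<open>e = Ft (k - 1) - F y'\<close> become
  constants, and only the coin and the two batches are random. With probability \<open>p k\<close> the
  new error is that of \<open>Fbar k\<close>. With probability \<open>1 - p k\<close> it is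
  \<open>e\<close> plus the mean of \<open>b k\<close> independent copies of \<open>BF y \<xi> - BF y' \<xi>\<close> minus their common
  expectation \<open>F y - F y'\<close>. These centred terms are orthogonal to each other and to \<open>e\<close>, so
  the mean square is \<open>(norm e)\<^sup>2\<close> plus a variance divided by \<open>b k\<close>, and the variance is
  at most the second moment \<open>Ebar\<close>. Averaging over the coin gives the recursion.

  Two ingredients make this rigorous. The first is the freezing lemma \<open>nn_cond_exp_frozen\<close>: the
  conditional expectation given an algebra, of a function of the past and of independent draws, is
  the integral over an independent copy of the draws. It needs joint independence of all sources
  of one iteration, which \<open>indep_set_join_algebra\<close> extracts from the independent family. The
  second is the variance bound \<open>nn_expectation_norm_sq_shifted_mean_le\<close> for vectors. All
  expectations of squares are taken in \<open>[0, \<infinity>]\<close>, and infinite ones are covered because the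
  corresponding bound is then infinite as well.

  The variance-reduction property follows by bounding the mega-batch error. Freezing the iterate
  turns the conditional error of \<open>Fbar k\<close> into the error at a deterministic point, at most
  \<open>\<sigma>\<^sup>2 / n k\<close>. The start is a restart with certainty and is treated separately.
\<close>

section \<open>Conditioning by freezing the past\<close>

text \<open>
  If \<open>G\<close> and \<open>H\<close> are independent sub-\<open>\<sigma>\<close>-algebras, the diagonal map
  \<open>\<omega> \<mapsto> (\<omega>, \<omega>)\<close> into \<open>G \<Otimes>\<^sub>M H\<close> has as its law the product of the two restrictions of the
  probability. Hence the occurrences of \<open>\<omega>\<close> that are seen through \<open>H\<close> may be replaced by an
  independent copy \<open>\<omega>'\<close>. Working with \<open>\<sigma>\<close>-algebras on the one space \<open>space M\<close>, instead of
  with random variables, allows the past, the coin and the samples to be treated alike although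
  they take values in different types.
\<close>

lemma (in prob_space) nn_integral_diagonal_indep:
  fixes h :: "'a \<times> 'a \<Rightarrow> ennreal"
  assumes G: "subalgebra M G" and H: "subalgebra M H"
    and indep: "indep_set (sets G) (sets H)"
    and h: "h \<in> borel_measurable (G \<Otimes>\<^sub>M H)"
  shows "(\<integral>\<^sup>+\<omega>. h (\<omega>, \<omega>) \<partial>M) = (\<integral>\<^sup>+\<omega>. \<integral>\<^sup>+\<omega>'. h (\<omega>, \<omega>') \<partial>M \<partial>M)"
proof -
  have spaces: "space G = space M" "space H = space M"
    using G H by (auto simp: subalgebra_def)
  have idG[measurable]: "(\<lambda>\<omega>. \<omega>) \<in> measurable M G" and idH[measurable]: "(\<lambda>\<omega>. \<omega>) \<in> measurable M H"
    using G H by (auto simp: subalgebra_def measurable_def)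
  have "indep_var G (\<lambda>\<omega>. \<omega>) H (\<lambda>\<omega>. \<omega>)"
  proof -
    have *: "{(\<lambda>\<omega>. \<omega>) -` A \<inter> space M |A. A \<in> sets K} = sets K" if "space K = space M" for K
    proof -
      have "{(\<lambda>\<omega>. \<omega>) -` A \<inter> space M |A. A \<in> sets K} = (\<lambda>A. A \<inter> space M) ` sets K"
        by (simp only: vimage_ident Setcompr_eq_image)
      also have "\<dots> = (\<lambda>A. A) ` sets K"
        using sets.sets_into_space[of _ K] that by (intro image_cong[OF refl]) blast
      finally show ?thesis by simp
    qed
    have "sigma_sets (space M) (sets G) = sets G" "sigma_sets (space M) (sets H) = sets H"
      using sets.sigma_sets_eq[of G] sets.sigma_sets_eq[of H] spaces by auto
    then show ?thesis
      using indep unfolding indep_var_eq *[OF spaces(1)] *[OF spaces(2)] using idG idH by auto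
  qed
  then have law: "distr M G (\<lambda>\<omega>. \<omega>) \<Otimes>\<^sub>M distr M H (\<lambda>\<omega>. \<omega>) = distr M (G \<Otimes>\<^sub>M H) (\<lambda>\<omega>. (\<omega>, \<omega>))"
    unfolding indep_var_distribution_eq by auto
  interpret DH: prob_space "distr M H (\<lambda>\<omega>. \<omega>)" by (rule prob_space_distr) simp
  have hm: "h \<in> borel_measurable (distr M G (\<lambda>\<omega>. \<omega>) \<Otimes>\<^sub>M distr M H (\<lambda>\<omega>. \<omega>))"
    using h by simp
  have sec: "(\<lambda>\<omega>'. h (\<omega>, \<omega>')) \<in> borel_measurable H" if "\<omega> \<in> space M" for \<omega>
    using measurable_compose_Pair1[OF _ h] that spaces by auto
  have outer: "(\<lambda>\<omega>. \<integral>\<^sup>+\<omega>'. h (\<omega>, \<omega>') \<partial>distr M H (\<lambda>\<omega>. \<omega>)) \<in> borel_measurable (distr M G (\<lambda>\<omega>. \<omega>))"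
    using DH.borel_measurable_nn_integral_fst[OF hm] .
  have "(\<integral>\<^sup>+\<omega>. h (\<omega>, \<omega>) \<partial>M) = (\<integral>\<^sup>+z. h z \<partial>distr M (G \<Otimes>\<^sub>M H) (\<lambda>\<omega>. (\<omega>, \<omega>)))"
    by (subst nn_integral_distr) (use h in auto)
  also have "\<dots> = (\<integral>\<^sup>+\<omega>. \<integral>\<^sup>+\<omega>'. h (\<omega>, \<omega>') \<partial>distr M H (\<lambda>\<omega>. \<omega>) \<partial>distr M G (\<lambda>\<omega>. \<omega>))"
    unfolding law[symmetric] using DH.nn_integral_fst[OF hm] by simp
  also have "\<dots> = (\<integral>\<^sup>+\<omega>. \<integral>\<^sup>+\<omega>'. h (\<omega>, \<omega>') \<partial>distr M H (\<lambda>\<omega>. \<omega>) \<partial>M)"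
    using outer by (subst nn_integral_distr) auto
  also have "\<dots> = (\<integral>\<^sup>+\<omega>. \<integral>\<^sup>+\<omega>'. h (\<omega>, \<omega>') \<partial>M \<partial>M)"
    by (intro nn_integral_cong) (subst nn_integral_distr, use sec in auto)
  finally show ?thesis .
qed

lemma (in prob_space) measurable_nn_integral_frozen:
  fixes h :: "'a \<times> 'a \<Rightarrow> ennreal"
  assumes H: "subalgebra M H" and h: "h \<in> borel_measurable (G \<Otimes>\<^sub>M H)"
  shows "(\<lambda>\<omega>. \<integral>\<^sup>+\<omega>'. h (\<omega>, \<omega>') \<partial>M) \<in> borel_measurable G"
proof -
  have idH[measurable]: "(\<lambda>\<omega>. \<omega>) \<in> measurable M H"
    using H by (auto simp: subalgebra_def measurable_def)
  have "h \<in> borel_measurable (G \<Otimes>\<^sub>M M)"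
  proof -
    have "(\<lambda>z. (fst z, snd z)) \<in> measurable (G \<Otimes>\<^sub>M M) (G \<Otimes>\<^sub>M H)"
      using measurable_compose[OF measurable_snd idH] by (intro measurable_Pair) auto
    from measurable_compose[OF this h] show ?thesis by simp
  qed
  then show ?thesis by (rule borel_measurable_nn_integral_fst)
qed

text \<open>
  The diagonal formula for the product kernel \<open>(\<omega>, \<omega>') \<mapsto> f \<omega> * g \<omega>'\<close>.
\<close>

lemma (in prob_space) nn_integral_mult_indep:
  fixes f g :: "'a \<Rightarrow> ennreal"
  assumes G: "subalgebra M G" and H: "subalgebra M H"
    and indep: "indep_set (sets G) (sets H)"
    and f: "f \<in> borel_measurable G" and g: "g \<in> borel_measurable H"
  shows "(\<integral>\<^sup>+\<omega>. f \<omega> * g \<omega> \<partial>M) = (\<integral>\<^sup>+\<omega>. f \<omega> \<partial>M) * (\<integral>\<^sup>+\<omega>. g \<omega> \<partial>M)"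
proof -
  have [measurable]: "f \<in> borel_measurable M" "g \<in> borel_measurable M"
    using measurable_from_subalg[OF G f] measurable_from_subalg[OF H g] by auto
  have "(\<lambda>z. f (fst z) * g (snd z)) \<in> borel_measurable (G \<Otimes>\<^sub>M H)"
    using f g by measurable
  from nn_integral_diagonal_indep[OF G H indep this]
  show ?thesis by (simp add: nn_integral_cmult nn_integral_multc)
qed

text \<open>
  Conditioning on \<open>G\<close> freezes what is \<open>G\<close>-measurable and averages over the rest. Testing against
  \<open>A \<in> sets G\<close> reduces this to the diagonal formula for the kernel
  \<open>(\<omega>, \<omega>') \<mapsto> indicator A \<omega> * h (\<omega>, \<omega>')\<close>.
\<close>

lemma (in prob_space) nn_cond_exp_frozen:
  fixes h :: "'a \<times> 'a \<Rightarrow> ennreal"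
  assumes G: "subalgebra M G" and H: "subalgebra M H"
    and indep: "indep_set (sets G) (sets H)"
    and h[measurable]: "h \<in> borel_measurable (G \<Otimes>\<^sub>M H)"
  shows "AE \<omega> in M. nn_cond_exp M G (\<lambda>\<omega>. h (\<omega>, \<omega>)) \<omega> = (\<integral>\<^sup>+\<omega>'. h (\<omega>, \<omega>') \<partial>M)"
proof -
  interpret finite_measure_subalgebra M G by standard (rule G)
  have spaces: "space G = space M" "space H = space M"
    using G H by (auto simp: subalgebra_def)
  have idG[measurable]: "(\<lambda>\<omega>. \<omega>) \<in> measurable M G" and idH[measurable]: "(\<lambda>\<omega>. \<omega>) \<in> measurable M H"
    using G H by (auto simp: subalgebra_def measurable_def)
  have diag: "(\<lambda>\<omega>. h (\<omega>, \<omega>)) \<in> borel_measurable M"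
    by (rule measurable_compose[OF _ h]) simp
  have sec: "(\<lambda>\<omega>'. h (\<omega>, \<omega>')) \<in> borel_measurable M" if "\<omega> \<in> space M" for \<omega>
    using measurable_from_subalg[OF H measurable_compose_Pair1[OF _ h]] that spaces by auto
  have "AE \<omega> in M. (\<integral>\<^sup>+\<omega>'. h (\<omega>, \<omega>') \<partial>M) = nn_cond_exp M G (\<lambda>\<omega>. h (\<omega>, \<omega>)) \<omega>"
  proof (rule nn_cond_exp_charact)
    fix A assume A[measurable]: "A \<in> sets G"
    have "(\<lambda>z. indicator A (fst z) * h z) \<in> borel_measurable (G \<Otimes>\<^sub>M H)"
      by measurable
    from nn_integral_diagonal_indep[OF G H indep this]
    have "(\<integral>\<^sup>+\<omega>. indicator A \<omega> * h (\<omega>, \<omega>) \<partial>M) = (\<integral>\<^sup>+\<omega>. \<integral>\<^sup>+\<omega>'. indicator A \<omega> * h (\<omega>, \<omega>') \<partial>M \<partial>M)"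
      by simp
    also have "\<dots> = (\<integral>\<^sup>+\<omega>. indicator A \<omega> * (\<integral>\<^sup>+\<omega>'. h (\<omega>, \<omega>') \<partial>M) \<partial>M)"
      by (intro nn_integral_cong nn_integral_cmult sec)
    finally show "(\<integral>\<^sup>+\<omega>\<in>A. h (\<omega>, \<omega>) \<partial>M) = (\<integral>\<^sup>+\<omega>\<in>A. (\<integral>\<^sup>+\<omega>'. h (\<omega>, \<omega>') \<partial>M) \<partial>M)"
      by (simp add: mult.commute)
  qed (use diag measurable_nn_integral_frozen[OF H h] in auto)
  then show ?thesis by (auto simp: eq_commute)
qed

section \<open>Joins of independent algebras\<close>

definition join_algebra :: "'a set \<Rightarrow> ('i \<Rightarrow> 'a measure) \<Rightarrow> 'i set \<Rightarrow> 'a measure" where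
  "join_algebra X G J = sigma X (\<Union>r\<in>J. sets (G r))"

lemma
  assumes "\<And>r. r \<in> J \<Longrightarrow> space (G r) = X"
  shows space_join_algebra: "space (join_algebra X G J) = X"
    and sets_join_algebra: "sets (join_algebra X G J) = sigma_sets X (\<Union>r\<in>J. sets (G r))"
proof -
  have *: "(\<Union>r\<in>J. sets (G r)) \<subseteq> Pow X"
    using assms sets.space_closed by blast
  show "space (join_algebra X G J) = X" "sets (join_algebra X G J) = sigma_sets X (\<Union>r\<in>J. sets (G r))"
    unfolding join_algebra_def using * by (simp_all add: space_measure_of_conv sets_measure_of)
qed

lemma measurable_join_algebra:
  assumes "\<And>r. r \<in> J \<Longrightarrow> space (G r) = X" and "r \<in> J" and "f \<in> measurable (G r) N"
  shows "f \<in> measurable (join_algebra X G J) N"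
proof -
  have "subalgebra (join_algebra X G J) (G r)"
    unfolding subalgebra_def using space_join_algebra[of J G X] sets_join_algebra[of J G X] assms(1,2) by auto
  then show ?thesis using assms(3) by (rule measurable_from_subalg)
qed

lemma subalgebra_join_algebra_mono:
  assumes "\<And>r. r \<in> K \<Longrightarrow> space (G r) = X" and "J \<subseteq> K"
  shows "subalgebra (join_algebra X G K) (join_algebra X G J)"
proof -
  have J: "space (G r) = X" if "r \<in> J" for r
    using assms that by auto
  note space_join_algebra[of J G X, OF J] sets_join_algebra[of J G X, OF J]
  moreover note space_join_algebra[of K G X, OF assms(1)] sets_join_algebra[of K G X, OF assms(1)]
  moreover have "sigma_sets X (\<Union>r\<in>J. sets (G r)) \<subseteq> sigma_sets X (\<Union>r\<in>K. sets (G r))"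
    using assms by (intro sigma_sets_subseteq) auto
  ultimately show ?thesis by (simp add: subalgebra_def)
qed

lemma subalgebra_join_algebra:
  assumes "\<And>r. r \<in> J \<Longrightarrow> subalgebra M (G r)"
  shows "subalgebra M (join_algebra (space M) G J)"
proof -
  have "\<And>r. r \<in> J \<Longrightarrow> space (G r) = space M" and sub: "(\<Union>r\<in>J. sets (G r)) \<subseteq> sets M"
    using assms by (auto simp: subalgebra_def)
  then show ?thesis
    unfolding subalgebra_def using space_join_algebra[of J G "space M"] sets_join_algebra[of J G "space M"]
      sets.sigma_sets_subset[OF sub] by auto
qed

text \<open>
  One member of an independent family is independent of everything that the remaining members
  generate. This groups the sources of randomness of one iteration: the past against all fresh
  draws, and the coin against all batches.
\<close>

lemma (in prob_space) indep_set_join_algebra: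
  assumes indep: "indep_sets (\<lambda>r. sets (G r)) I"
    and spaces: "\<And>r. r \<in> I \<Longrightarrow> space (G r) = space M"
    and rK: "r \<in> I" "K \<subseteq> I" "r \<notin> K"
  shows "indep_set (sets (G r)) (sets (join_algebra (space M) G K))"
proof -
  have "indep_sets (\<lambda>j. sigma_sets (space M) (\<Union>r\<in>case_bool {r} K j. sets (G r))) UNIV"
  proof (rule indep_sets_collect_sigma)
    show "indep_sets (\<lambda>r. sets (G r)) (\<Union>j\<in>UNIV. case_bool {r} K j)"
      by (rule indep_sets_mono_index[OF _ indep]) (use rK in \<open>auto split: bool.splits\<close>)
    show "disjoint_family_on (case_bool {r} K) UNIV"
      using rK by (auto simp: disjoint_family_on_def split: bool.splits)
  qed (rule sets.Int_stable)
  also have "(\<lambda>j. sigma_sets (space M) (\<Union>r\<in>case_bool {r} K j. sets (G r)))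
      = case_bool (sets (G r)) (sets (join_algebra (space M) G K))"
  proof
    have "sigma_sets (space M) (sets (G r)) = sets (G r)"
      using sets.sigma_sets_eq[of "G r"] spaces rK by simp
    moreover have "sigma_sets (space M) (\<Union>r\<in>K. sets (G r)) = sets (join_algebra (space M) G K)"
      using spaces rK by (subst sets_join_algebra) auto
    ultimately show "sigma_sets (space M) (\<Union>r\<in>case_bool {r} K j. sets (G r))
        = case_bool (sets (G r)) (sets (join_algebra (space M) G K)) j" for j
      by (cases j) simp_all
  qed
  finally show ?thesis unfolding indep_set_def .
qed

section \<open>The mean square of a shifted batch mean\<close>

text \<open>
  The inner product is a sum over coordinates of products of independent real variables, for
  which integrability of the factors already gives integrability of the product.
\<close>

lemma (in prob_space) expectation_inner_indep:
  fixes X Y :: "'a \<Rightarrow> 'b::euclidean_space"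
  assumes indep: "indep_var borel X borel Y"
    and int: "integrable M X" "integrable M Y"
  shows "integrable M (\<lambda>\<omega>. X \<omega> \<bullet> Y \<omega>)"
    and "expectation (\<lambda>\<omega>. X \<omega> \<bullet> Y \<omega>) = expectation X \<bullet> expectation Y"
proof -
  have ind: "indep_var borel (\<lambda>\<omega>. X \<omega> \<bullet> c) borel (\<lambda>\<omega>. Y \<omega> \<bullet> c)" for c
    using indep_var_compose[OF indep, of "\<lambda>v. v \<bullet> c" borel "\<lambda>v. v \<bullet> c" borel] by (simp add: comp_def)
  have int_c: "integrable M (\<lambda>\<omega>. (X \<omega> \<bullet> c) * (Y \<omega> \<bullet> c))" for c
    using indep_var_integrable[OF ind] int by auto
  have coords: "(\<lambda>\<omega>. X \<omega> \<bullet> Y \<omega>) = (\<lambda>\<omega>. \<Sum>c\<in>Basis. (X \<omega> \<bullet> c) * (Y \<omega> \<bullet> c))"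
    by (intro ext euclidean_inner)
  show "integrable M (\<lambda>\<omega>. X \<omega> \<bullet> Y \<omega>)"
    unfolding coords using int_c by simp
  have "expectation (\<lambda>\<omega>. X \<omega> \<bullet> Y \<omega>) = (\<Sum>c\<in>Basis. expectation (\<lambda>\<omega>. X \<omega> \<bullet> c) * expectation (\<lambda>\<omega>. Y \<omega> \<bullet> c))"
    unfolding coords using int_c indep_var_lebesgue_integral[OF ind] int by simp
  also have "\<dots> = expectation X \<bullet> expectation Y"
    using int by (subst euclidean_inner[of "expectation X"]) simp
  finally show "expectation (\<lambda>\<omega>. X \<omega> \<bullet> Y \<omega>) = expectation X \<bullet> expectation Y" .
qed

lemma (in prob_space) indep_sets_reindex:
  assumes inj: "inj_on g I" and indep: "indep_sets E (g ` I)"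
  shows "indep_sets (\<lambda>i. E (g i)) I"
  unfolding indep_sets_def
proof (intro conjI ballI allI impI)
  show "E (g i) \<subseteq> events" if "i \<in> I" for i
    using indep that unfolding indep_sets_def by blast
  fix J A
  assume J: "J \<subseteq> I" "J \<noteq> {}" "finite J" and A: "A \<in> (\<Pi> i\<in>J. E (g i))"
  have injJ: "inj_on g J" using inj J(1) by (rule inj_on_subset)
  \<comment> \<open>Any choice of sets on \<open>J\<close> is transported to \<open>g ` J\<close>, which needs \<open>g\<close> to be injective there.\<close>
  define A' where "A' r = A (the_inv_into J g r)" for r
  have A': "A' (g i) = A i" if "i \<in> J" for i
    using that by (simp add: A'_def the_inv_into_f_f[OF injJ])
  have "prob (\<Inter>r\<in>g ` J. A' r) = (\<Prod>r\<in>g ` J. prob (A' r))"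
  proof (rule indep_setsD[OF indep])
    show "\<forall>r\<in>g ` J. A' r \<in> E r" using A A' by (auto simp: Pi_iff)
  qed (use J in auto)
  then show "prob (\<Inter>i\<in>J. A i) = (\<Prod>i\<in>J. prob (A i))"
    using A' by (simp add: prod.reindex[OF injJ])
qed

lemma (in prob_space) indep_var_of_indep_vars:
  assumes indep: "indep_vars (\<lambda>_. N) X I" and "i \<in> I" "j \<in> I" "i \<noteq> j"
  shows "indep_var N (X i) N (X j)"
proof -
  \<comment> \<open>Disjoint blocks of an independent family are independent; here both blocks are singletons.\<close>
  have "indep_var (Pi\<^sub>M {i} (\<lambda>_. N)) (\<lambda>\<omega>. restrict (\<lambda>l. X l \<omega>) {i}) (Pi\<^sub>M {j} (\<lambda>_. N)) (\<lambda>\<omega>. restrict (\<lambda>l. X l \<omega>) {j})"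
    by (rule indep_var_restrict[OF indep]) (use assms in auto)
  from indep_var_compose[OF this, of "\<lambda>f. f i" N "\<lambda>f. f j" N]
  show ?thesis by (simp add: comp_def measurable_component_singleton)
qed

text \<open>
  Independent centred vectors are orthogonal to each other and to the constant \<open>e\<close> in
  \<open>L\<^sup>2\<close>, so this is the theorem of Pythagoras.
\<close>

lemma (in prob_space) expectation_norm_sq_shifted_sum:
  fixes X :: "'i \<Rightarrow> 'a \<Rightarrow> 'b::euclidean_space"
  assumes "finite I"
    and indep: "indep_vars (\<lambda>_. borel) X I"
    and int: "\<And>i. i \<in> I \<Longrightarrow> integrable M (X i)"
    and centred: "\<And>i. i \<in> I \<Longrightarrow> expectation (X i) = 0"
    and sq: "\<And>i. i \<in> I \<Longrightarrow> integrable M (\<lambda>\<omega>. (norm (X i \<omega>))\<^sup>2)"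
  shows "integrable M (\<lambda>\<omega>. (norm (e + (\<Sum>i\<in>I. X i \<omega>)))\<^sup>2)"
    and "expectation (\<lambda>\<omega>. (norm (e + (\<Sum>i\<in>I. X i \<omega>)))\<^sup>2)
      = (norm e)\<^sup>2 + (\<Sum>i\<in>I. expectation (\<lambda>\<omega>. (norm (X i \<omega>))\<^sup>2))"
proof -
  have expand: "(norm (e + (\<Sum>i\<in>I. X i \<omega>)))\<^sup>2
      = (norm e)\<^sup>2 + 2 * (\<Sum>i\<in>I. e \<bullet> X i \<omega>) + (\<Sum>i\<in>I. \<Sum>j\<in>I. X i \<omega> \<bullet> X j \<omega>)" for \<omega>
    by (simp add: power2_norm_eq_inner inner_add_left inner_add_right inner_sum_left inner_sum_right
        inner_commute sum.distrib algebra_simps)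
  have pair: "integrable M (\<lambda>\<omega>. X i \<omega> \<bullet> X j \<omega>)
      \<and> expectation (\<lambda>\<omega>. X i \<omega> \<bullet> X j \<omega>) = (if i = j then expectation (\<lambda>\<omega>. (norm (X i \<omega>))\<^sup>2) else 0)"
    if "i \<in> I" "j \<in> I" for i j
  proof (cases "i = j")
    case True
    then show ?thesis using sq[OF that(1)] by (simp add: power2_norm_eq_inner)
  next
    case False
    have "indep_var borel (X i) borel (X j)"
      using indep_var_of_indep_vars[OF indep that False] .
    from expectation_inner_indep[OF this int[OF that(1)] int[OF that(2)]] show ?thesis
      using False centred that by simp
  qed
  have cross: "integrable M (\<lambda>\<omega>. e \<bullet> X i \<omega>) \<and> expectation (\<lambda>\<omega>. e \<bullet> X i \<omega>) = 0" if "i \<in> I" for i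
    using int[OF that] centred[OF that] by simp
  show "integrable M (\<lambda>\<omega>. (norm (e + (\<Sum>i\<in>I. X i \<omega>)))\<^sup>2)"
    unfolding expand using pair cross by auto
  show "expectation (\<lambda>\<omega>. (norm (e + (\<Sum>i\<in>I. X i \<omega>)))\<^sup>2)
      = (norm e)\<^sup>2 + (\<Sum>i\<in>I. expectation (\<lambda>\<omega>. (norm (X i \<omega>))\<^sup>2))"
    unfolding expand using pair cross \<open>finite I\<close> by (simp add: prob_space sum.delta)
qed

text \<open>
  A batch of size \<open>m\<close> divides the variance by \<open>m\<close>, and the variance is at most the second
  moment. With \<open>v\<close> in \<open>[0, \<infinity>]\<close> the bound is vacuous when the second moment is infinite, and
  otherwise Pythagoras applies.
\<close>

lemma (in prob_space) nn_expectation_norm_sq_shifted_mean_le: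
  fixes X :: "nat \<Rightarrow> 'a \<Rightarrow> 'b::euclidean_space"
  assumes m: "1 \<le> m"
    and indep: "indep_vars (\<lambda>_. borel) X {..<m}"
    and int: "\<And>i. i < m \<Longrightarrow> integrable M (X i)"
    and mean: "\<And>i. i < m \<Longrightarrow> expectation (X i) = \<mu>"
    and second_moment: "\<And>i. i < m \<Longrightarrow> (\<integral>\<^sup>+\<omega>. ennreal ((norm (X i \<omega>))\<^sup>2) \<partial>M) = v"
  shows "(\<integral>\<^sup>+\<omega>. ennreal ((norm (e + (1 / real m) *\<^sub>R (\<Sum>i<m. X i \<omega>) - \<mu>))\<^sup>2) \<partial>M)
      \<le> ennreal ((norm e)\<^sup>2) + ennreal (1 / real m) * v"
proof (cases "v = \<infinity>")
  case True
  then show ?thesis using m by (simp add: ennreal_mult_top)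
next
  case False
  define r where "r = enn2real v"
  have v: "v = ennreal r" "0 \<le> r" using False by (auto simp: r_def less_top)
  \<comment> \<open>The weight \<open>1 / m\<close> is put into the summands, so that their sum is the error of the batch mean.\<close>
  define Y where "Y i \<omega> = (1 / real m) *\<^sub>R (X i \<omega> - \<mu>)" for i \<omega>
  have sqX: "integrable M (\<lambda>\<omega>. (norm (X i \<omega>))\<^sup>2) \<and> expectation (\<lambda>\<omega>. (norm (X i \<omega>))\<^sup>2) = r"
    if "i < m" for i
  proof -
    have [measurable]: "X i \<in> borel_measurable M" using int[OF that] by auto
    have "integrable M (\<lambda>\<omega>. (norm (X i \<omega>))\<^sup>2)"
      by (rule integrableI_nn_integral_finite[of _ _ r]) (use second_moment[OF that] v in auto)
    then show ?thesis
      using nn_integral_eq_integral[of M "\<lambda>\<omega>. (norm (X i \<omega>))\<^sup>2"] second_moment[OF that] v by auto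
  qed
  have intY: "integrable M (Y i)" and centred: "expectation (Y i) = 0" if "i < m" for i
    unfolding Y_def using int[OF that] mean[OF that] by (simp_all add: prob_space)
  have sqY_eq: "(norm (Y i \<omega>))\<^sup>2
      = (1 / real m)\<^sup>2 * ((norm (X i \<omega>))\<^sup>2 - 2 * (X i \<omega> \<bullet> \<mu>) + (norm \<mu>)\<^sup>2)" for i \<omega>
  proof -
    have "(norm (X i \<omega> - \<mu>))\<^sup>2 = (norm (X i \<omega>))\<^sup>2 - 2 * (X i \<omega> \<bullet> \<mu>) + (norm \<mu>)\<^sup>2"
      unfolding power2_norm_eq_inner inner_diff_left inner_diff_right by (simp add: inner_commute)
    then show ?thesis by (simp add: Y_def power_mult_distrib power_divide)
  qed
  have sqY: "integrable M (\<lambda>\<omega>. (norm (Y i \<omega>))\<^sup>2)" if "i < m" for i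
    unfolding sqY_eq using sqX[OF that] int[OF that] by auto
  have EsqY: "expectation (\<lambda>\<omega>. (norm (Y i \<omega>))\<^sup>2) \<le> (1 / real m)\<^sup>2 * r" if "i < m" for i
  proof -
    have "expectation (\<lambda>\<omega>. (norm (Y i \<omega>))\<^sup>2) = (1 / real m)\<^sup>2 * (r - (norm \<mu>)\<^sup>2)"
      unfolding sqY_eq using sqX[OF that] int[OF that] mean[OF that]
      by (simp add: prob_space power2_norm_eq_inner)
    also have "\<dots> \<le> (1 / real m)\<^sup>2 * r" by (intro mult_left_mono) auto
    finally show ?thesis .
  qed
  have indepY: "indep_vars (\<lambda>_. borel) Y {..<m}"
    unfolding Y_def by (rule indep_vars_compose2[OF indep]) auto
  have sum_eq: "e + (1 / real m) *\<^sub>R (\<Sum>i<m. X i \<omega>) - \<mu> = e + (\<Sum>i<m. Y i \<omega>)" for \<omega>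
  proof -
    have "(\<Sum>i<m. Y i \<omega>) = (1 / real m) *\<^sub>R (\<Sum>i<m. X i \<omega> - \<mu>)"
      by (simp only: Y_def scaleR_sum_right)
    also have "\<dots> = (1 / real m) *\<^sub>R (\<Sum>i<m. X i \<omega>) - \<mu>"
      using m by (simp add: sum_subtractf sum_constant_scaleR scaleR_diff_right)
    finally show ?thesis by simp
  qed
  note shifted = expectation_norm_sq_shifted_sum[where I = "{..<m}" and X = Y and e = e,
      OF _ indepY intY centred sqY]
  have "(\<integral>\<^sup>+\<omega>. ennreal ((norm (e + (\<Sum>i<m. Y i \<omega>)))\<^sup>2) \<partial>M)
      = ennreal (expectation (\<lambda>\<omega>. (norm (e + (\<Sum>i<m. Y i \<omega>)))\<^sup>2))"
    by (rule nn_integral_eq_integral) (use shifted(1) in auto)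
  also have "\<dots> = ennreal ((norm e)\<^sup>2 + (\<Sum>i<m. expectation (\<lambda>\<omega>. (norm (Y i \<omega>))\<^sup>2)))"
    using shifted(2) by simp
  also have "\<dots> \<le> ennreal ((norm e)\<^sup>2 + (\<Sum>i<m. (1 / real m)\<^sup>2 * r))"
    using EsqY by (intro ennreal_leI add_left_mono sum_mono) auto
  also have "\<dots> = ennreal ((norm e)\<^sup>2 + 1 / real m * r)"
    using m by (simp add: power2_eq_square)
  also have "\<dots> = ennreal ((norm e)\<^sup>2) + ennreal (1 / real m) * v"
    using v by (subst ennreal_plus) (simp_all add: ennreal_mult'[of "1 / real m" r, symmetric])
  finally show ?thesis unfolding sum_eq .
qed

section \<open>Measurability and adaptedness of the estimator\<close>

lemma subalgebra_vimage_algebra: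
  assumes "f \<in> measurable M N"
  shows "subalgebra M (vimage_algebra (space M) f N)"
proof -
  have "f \<in> space M \<rightarrow> space N" using assms by (auto simp: measurable_def)
  then show ?thesis
    unfolding subalgebra_def using assms by (auto simp: sets_vimage_algebra2)
qed

context l_sarah
begin

text \<open>
  A finite sum is the integral with respect to the uniform distribution on its index set, so both
  settings make \<open>F\<close> the mean of an integrable oracle.
\<close>

lemma
  shows integrable_oracle: "integrable D (BF y)"
    and F_eq_integral: "F y = (\<integral>\<xi>. BF y \<xi> \<partial>D)"
proof -
  have "integrable D (BF y) \<and> F y = (\<integral>\<xi>. BF y \<xi> \<partial>D)"
    using setting
  proof
    assume "finite_sum_setting D BF F"
    then obtain I where I: "finite I" "I \<noteq> {}" "D = uniform_count_measure I"
      "F y = (1 / real (card I)) *\<^sub>R (\<Sum>i\<in>I. BF y i)"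
      unfolding finite_sum_setting_def by auto
    then show ?thesis
      by (simp add: uniform_count_measure_def integrable_point_measure_finite
          lebesgue_integral_point_measure_finite scaleR_sum_right)
  qed (auto simp: expectation_setting_def)
  then show "integrable D (BF y)" "F y = (\<integral>\<xi>. BF y \<xi> \<partial>D)" by auto
qed

lemma measurable_F[measurable]: "F \<in> borel_measurable borel"
proof -
  interpret D: prob_space D by (rule sample_law)
  have "(\<lambda>y. \<integral>\<xi>. BF y \<xi> \<partial>D) \<in> borel_measurable borel"
    using oracle_measurable by (intro D.borel_measurable_lebesgue_integral) simp
  then show ?thesis unfolding F_eq_integral[symmetric] by simp
qed

lemma measurable_oracle:
  assumes "y \<in> borel_measurable N" and "s \<in> measurable N D"
  shows "(\<lambda>\<omega>. BF (y \<omega>) (s \<omega>)) \<in> borel_measurable N"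
  using measurable_compose[OF measurable_Pair[OF assms] oracle_measurable] by simp

lemma measurable_batch_mean:
  assumes "y \<in> borel_measurable N" and "\<And>i. i < m \<Longrightarrow> s i \<in> measurable N D"
  shows "(\<lambda>\<omega>. batch_mean BF m (\<lambda>i. s i \<omega>) (y \<omega>)) \<in> borel_measurable N"
  unfolding batch_mean_def using measurable_oracle[OF assms] by measurable

lemma space_Fil[simp]: "space (Fil k) = space M"
  using Fil_subalgebra[of k] by (simp add: subalgebra_def)

lemma measurable_Fil_imp_M: "f \<in> measurable (Fil k) N \<Longrightarrow> f \<in> measurable M N"
  by (rule measurable_from_subalg[OF Fil_subalgebra])

lemma measurable_Fil_Suc: "f \<in> measurable (Fil k) N \<Longrightarrow> f \<in> measurable (Fil (Suc k)) N"
  by (rule measurable_from_subalg)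
    (use filtration.sets_F_mono[OF Fil_filtration, of k "Suc k"] in \<open>auto simp: subalgebra_def\<close>)

lemma Fbar_adapted: "Fbar k \<in> borel_measurable (Fil (Suc k))"
proof -
  have "(\<lambda>\<omega>. if full k then F (x k \<omega>) else batch_mean BF (n k) (\<lambda>i. Z k i \<omega>) (x k \<omega>))
      \<in> borel_measurable (Fil (Suc k))"
    using measurable_compose[OF measurable_Fil_Suc[OF iterate_measurable] measurable_F]
      measurable_batch_mean[OF measurable_Fil_Suc[OF iterate_measurable] Z_measurable]
    by (cases "full k") simp_all
  then show ?thesis
    by (rule measurable_cong[THEN iffD1, rotated]) (simp add: Fbar_eq)
qed

text \<open>
  The estimator before iteration \<open>k\<close> belongs to the past of iteration \<open>k\<close>, which is what
  makes the previous error a constant in the conditional expectation.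
\<close>

lemma Ft_adapted: "Ft k \<in> borel_measurable (Fil (Suc k))"
proof (induction k)
  case 0
  show ?case
    by (rule measurable_cong[THEN iffD1, OF _ Fbar_adapted]) (simp add: Ft_0)
next
  case (Suc k)
  have batch: "(\<lambda>\<omega>. batch_mean BF (b (Suc k)) (\<lambda>i. S (Suc k) i \<omega>) (y \<omega>)) \<in> borel_measurable (Fil (Suc (Suc k)))"
    if "y \<in> borel_measurable (Fil (Suc (Suc k)))" for y
    by (rule measurable_batch_mean[OF that S_measurable])
  note [measurable] = measurable_Fil_Suc[OF Suc] coin_measurable[of "Suc k"] Fbar_adapted[of "Suc k"]
    batch[OF measurable_Fil_Suc[OF iterate_measurable]]
    batch[OF measurable_Fil_Suc[OF measurable_Fil_Suc[OF iterate_measurable]]]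
  have "(\<lambda>\<omega>. if coin (Suc k) \<omega> then Fbar (Suc k) \<omega>
             else Ft k \<omega> + batch_mean BF (b (Suc k)) (\<lambda>i. S (Suc k) i \<omega>) (x (Suc k) \<omega>)
                         - batch_mean BF (b (Suc k)) (\<lambda>i. S (Suc k) i \<omega>) (x k \<omega>))
      \<in> borel_measurable (Fil (Suc (Suc k)))"
    by measurable
  then show ?case
    by (rule measurable_cong[THEN iffD1, rotated]) (simp add: Ft_Suc)
qed

definition err :: "nat \<Rightarrow> 'w \<Rightarrow> real ^ 'p" where
  "err k \<omega> = Ft k \<omega> - F (x k \<omega>)"

lemma err_adapted: "err k \<in> borel_measurable (Fil (Suc k))"
  unfolding err_def[abs_def]
  using Ft_adapted[of k] measurable_compose[OF measurable_Fil_Suc[OF iterate_measurable[of k]] measurable_F]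
  by measurable

section \<open>Independence of the sources of one iteration\<close>

definition source_algebra :: "nat \<Rightarrow> source \<Rightarrow> 'w measure" where
  "source_algebra k r = (case r of
      Past \<Rightarrow> Fil k
    | Coin \<Rightarrow> vimage_algebra (space M) (coin k) (count_space UNIV)
    | Sample i \<Rightarrow> vimage_algebra (space M) (S k i) D
    | Mega \<Rightarrow> vimage_algebra (space M) (\<lambda>\<omega>. \<lambda>i\<in>{..<n k}. Z k i \<omega>) (Pi\<^sub>M {..<n k} (\<lambda>_. D)))"

definition batches :: "nat \<Rightarrow> source set" where
  "batches k = insert Mega (Sample ` {..<b k})"

text \<open>
  The coin is kept apart from the batches: the past is independent of \<open>fresh_algebra k\<close>, which
  removes the conditioning, and the coin is independent of \<open>batches_algebra k\<close>, which separates
  the two branches of the estimator.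
\<close>

definition fresh_algebra :: "nat \<Rightarrow> 'w measure" where
  "fresh_algebra k = join_algebra (space M) (source_algebra k) (insert Coin (batches k))"

definition batches_algebra :: "nat \<Rightarrow> 'w measure" where
  "batches_algebra k = join_algebra (space M) (source_algebra k) (batches k)"

lemma sources_indep:
  "indep_sets (\<lambda>r. sets (source_algebra k r)) (insert Past (insert Coin (batches k)))"
proof -
  have "(\<lambda>r. sets (source_algebra k r)) = (\<lambda>r. case r of
              Past \<Rightarrow> sets (Fil k)
            | Coin \<Rightarrow> sets (vimage_algebra (space M) (coin k) (count_space UNIV))
            | Sample i \<Rightarrow> sets (vimage_algebra (space M) (S k i) D)
            | Mega \<Rightarrow> sets (vimage_algebra (space M) (\<lambda>\<omega>. \<lambda>i\<in>{..<n k}. Z k i \<omega>)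
                                (Pi\<^sub>M {..<n k} (\<lambda>_. D))))"
    by (rule ext) (simp add: source_algebra_def split: source.split)
  moreover have "insert Past (insert Coin (batches k)) = {Past, Coin, Mega} \<union> Sample ` {..<b k}"
    by (auto simp: batches_def)
  ultimately show ?thesis using draws_indep[of k] by metis
qed

lemma coin_M: "coin k \<in> measurable M (count_space UNIV)"
  by (rule measurable_Fil_imp_M[OF coin_measurable])

lemma S_M: "i < b k \<Longrightarrow> S k i \<in> measurable M D"
  by (rule measurable_Fil_imp_M[OF S_measurable])

lemma Z_M: "(\<lambda>\<omega>. \<lambda>i\<in>{..<n k}. Z k i \<omega>) \<in> measurable M (Pi\<^sub>M {..<n k} (\<lambda>_. D))"
  using measurable_Fil_imp_M[OF Z_measurable] by (intro measurable_restrict) auto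

lemma source_subalgebra:
  "r \<in> insert Past (insert Coin (batches k)) \<Longrightarrow> subalgebra M (source_algebra k r)"
  using Fil_subalgebra subalgebra_vimage_algebra[OF coin_M] subalgebra_vimage_algebra[OF S_M]
    subalgebra_vimage_algebra[OF Z_M]
  by (auto simp: source_algebra_def batches_def)

lemma space_source: "r \<in> insert Past (insert Coin (batches k)) \<Longrightarrow> space (source_algebra k r) = space M"
  using source_subalgebra by (auto simp: subalgebra_def)

lemma batches_subalgebra: "subalgebra M (batches_algebra k)"
  unfolding batches_algebra_def by (rule subalgebra_join_algebra) (rule source_subalgebra, auto)

lemma fresh_subalgebra: "subalgebra M (fresh_algebra k)"
  unfolding fresh_algebra_def by (rule subalgebra_join_algebra) (rule source_subalgebra, auto)

lemma past_indep_fresh: "indep_set (sets (Fil k)) (sets (fresh_algebra k))"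
proof -
  have "indep_set (sets (source_algebra k Past)) (sets (fresh_algebra k))"
    unfolding fresh_algebra_def
    by (rule indep_set_join_algebra[OF sources_indep space_source]) (auto simp: batches_def)
  then show ?thesis by (simp add: source_algebra_def)
qed

lemma coin_indep_batches: "indep_set (sets (source_algebra k Coin)) (sets (batches_algebra k))"
  unfolding batches_algebra_def
  by (rule indep_set_join_algebra[OF sources_indep space_source]) (auto simp: batches_def)

lemma coin_source_measurable: "coin k \<in> measurable (source_algebra k Coin) (count_space UNIV)"
  unfolding source_algebra_def by (simp add: measurable_vimage_algebra1)

lemma coin_fresh_measurable: "coin k \<in> measurable (fresh_algebra k) (count_space UNIV)"
  unfolding fresh_algebra_def
  by (rule measurable_join_algebra[where G = "source_algebra k", OF space_source _ coin_source_measurable]) auto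

lemma S_batches_measurable:
  assumes "i < b k"
  shows "S k i \<in> measurable (batches_algebra k) D"
proof -
  have "S k i \<in> space M \<rightarrow> space D"
    using S_M[OF assms] by (auto simp: measurable_def)
  then have "S k i \<in> measurable (source_algebra k (Sample i)) D"
    unfolding source_algebra_def by (simp add: measurable_vimage_algebra1)
  then show ?thesis
    unfolding batches_algebra_def
    by (rule measurable_join_algebra[OF space_source, rotated 2]) (use assms in \<open>auto simp: batches_def\<close>)
qed

lemma Z_batches_measurable:
  assumes "i < n k"
  shows "Z k i \<in> measurable (batches_algebra k) D"
proof -
  let ?Z = "\<lambda>\<omega>. \<lambda>i\<in>{..<n k}. Z k i \<omega>"
  have "?Z \<in> space M \<rightarrow> space (Pi\<^sub>M {..<n k} (\<lambda>_. D))"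
    using Z_M by (auto simp: measurable_def)
  then have "?Z \<in> measurable (source_algebra k Mega) (Pi\<^sub>M {..<n k} (\<lambda>_. D))"
    unfolding source_algebra_def by (simp add: measurable_vimage_algebra1)
  then have "?Z \<in> measurable (batches_algebra k) (Pi\<^sub>M {..<n k} (\<lambda>_. D))"
    unfolding batches_algebra_def
    by (rule measurable_join_algebra[OF space_source, rotated 2]) (auto simp: batches_def)
  from measurable_compose[OF this measurable_component_singleton[of i "{..<n k}" "\<lambda>_. D"]]
  show ?thesis using assms by simp
qed

lemma batches_sub_fresh:
  assumes "f \<in> measurable (batches_algebra k) N"
  shows "f \<in> measurable (fresh_algebra k) N"
proof -
  have "subalgebra (fresh_algebra k) (batches_algebra k)"
    unfolding fresh_algebra_def batches_algebra_def
    by (rule subalgebra_join_algebra_mono[OF space_source]) auto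
  then show ?thesis using assms by (rule measurable_from_subalg)
qed

text \<open>
  The law of total expectation over the coin. On each branch the indicator of the coin factors
  out, as the coin is independent of the batches.
\<close>

lemma nn_integral_coin_split:
  fixes A B :: "'w \<Rightarrow> ennreal"
  assumes k: "1 \<le> k"
    and A: "A \<in> borel_measurable (batches_algebra k)" and B: "B \<in> borel_measurable (batches_algebra k)"
  shows "(\<integral>\<^sup>+\<omega>. (if coin k \<omega> then A \<omega> else B \<omega>) \<partial>M)
      = ennreal (p k) * (\<integral>\<^sup>+\<omega>. A \<omega> \<partial>M) + ennreal (1 - p k) * (\<integral>\<^sup>+\<omega>. B \<omega> \<partial>M)"
proof -
  have [measurable]: "A \<in> borel_measurable M" "B \<in> borel_measurable M" "coin k \<in> measurable M (count_space UNIV)"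
    using measurable_from_subalg[OF batches_subalgebra] A B coin_M by auto
  have "subalgebra M (source_algebra k Coin)" by (rule source_subalgebra) simp
  note prod = nn_integral_mult_indep[OF this batches_subalgebra coin_indep_batches]
  let ?h = "\<lambda>\<omega>. if coin k \<omega> then 1 else 0 :: ennreal"
  let ?t = "\<lambda>\<omega>. if coin k \<omega> then 0 else 1 :: ennreal"
  note [measurable] = coin_source_measurable[of k]
  have h: "?h \<in> borel_measurable (source_algebra k Coin)" by measurable
  have t: "?t \<in> borel_measurable (source_algebra k Coin)" by measurable
  have [measurable]: "?h \<in> borel_measurable M" "?t \<in> borel_measurable M" by measurable
  have heads: "(\<integral>\<^sup>+\<omega>. ?h \<omega> \<partial>M) = ennreal (p k)"
  proof -
    have "(\<integral>\<^sup>+\<omega>. ?h \<omega> \<partial>M) = (\<integral>\<^sup>+\<omega>. indicator {\<omega>\<in>space M. coin k \<omega>} \<omega> \<partial>M)"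
      by (intro nn_integral_cong) (auto simp: indicator_def)
    then show ?thesis using coin_law[OF k] by (simp add: emeasure_eq_measure)
  qed
  have tails: "(\<integral>\<^sup>+\<omega>. ?t \<omega> \<partial>M) = ennreal (1 - p k)"
  proof -
    have "(\<integral>\<^sup>+\<omega>. ?t \<omega> \<partial>M) = (\<integral>\<^sup>+\<omega>. indicator (space M - {\<omega>\<in>space M. coin k \<omega>}) \<omega> \<partial>M)"
      by (intro nn_integral_cong) (auto simp: indicator_def)
    then show ?thesis using coin_law[OF k] by (simp add: emeasure_eq_measure prob_compl)
  qed
  have "(\<integral>\<^sup>+\<omega>. (if coin k \<omega> then A \<omega> else B \<omega>) \<partial>M) = (\<integral>\<^sup>+\<omega>. ?h \<omega> * A \<omega> + ?t \<omega> * B \<omega> \<partial>M)"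
    by (intro nn_integral_cong) (auto simp: indicator_def)
  also have "\<dots> = (\<integral>\<^sup>+\<omega>. ?h \<omega> * A \<omega> \<partial>M) + (\<integral>\<^sup>+\<omega>. ?t \<omega> * B \<omega> \<partial>M)"
    by (rule nn_integral_add) measurable
  finally show ?thesis unfolding prod[OF h A] prod[OF t B] heads tails .
qed

lemma samples_indep: "indep_vars (\<lambda>_. D) (S k) {..<b k}"
  unfolding indep_vars_def2
proof
  have "indep_sets (\<lambda>r. sets (source_algebra k r)) (Sample ` {..<b k})"
    by (rule indep_sets_mono_index[OF _ sources_indep]) (auto simp: batches_def)
  then have *: "indep_sets (\<lambda>i. sets (source_algebra k (Sample i))) {..<b k}"
    by (rule indep_sets_reindex[rotated]) (simp add: inj_on_def)
  show "indep_sets (\<lambda>i. {S k i -` A \<inter> space M |A. A \<in> sets D}) {..<b k}"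
    by (rule indep_sets_mono_sets[OF *]) (auto simp: source_algebra_def intro: in_vimage_algebra)
qed (simp add: S_M)

section \<open>The error recursion\<close>

text \<open>
  The recursive branch for fixed \<open>x k = y\<close>, \<open>x (k - 1) = y'\<close> and previous error \<open>e\<close>. The
  increments \<open>BF y \<xi> - BF y' \<xi>\<close> have mean \<open>F y - F y'\<close>, so the batch adds to \<open>e\<close> a centred
  error of size at most the second moment of one increment divided by the batch size. One batch
  evaluates both points; this is why the increment, and not the oracle itself, controls the
  variance.
\<close>

lemma batch_error_bound:
  assumes k: "1 \<le> k"
  shows "(\<integral>\<^sup>+\<omega>. ennreal ((norm (e + (batch_mean BF (b k) (\<lambda>i. S k i \<omega>) y - batch_mean BF (b k) (\<lambda>i. S k i \<omega>) y')
            - (F y - F y')))\<^sup>2) \<partial>M)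
      \<le> ennreal ((norm e)\<^sup>2) + ennreal (1 / real (b k)) * (\<integral>\<^sup>+\<xi>. ennreal ((norm (BF y \<xi> - BF y' \<xi>))\<^sup>2) \<partial>D)"
proof -
  let ?d = "\<lambda>\<xi>. BF y \<xi> - BF y' \<xi>"
  have int_d: "integrable D ?d" and mean_d: "(\<integral>\<xi>. ?d \<xi> \<partial>D) = F y - F y'"
    using integrable_oracle by (simp_all add: F_eq_integral)
  have d[measurable]: "?d \<in> borel_measurable D" using int_d by auto
  have "(\<integral>\<^sup>+\<omega>. ennreal ((norm (e + (1 / real (b k)) *\<^sub>R (\<Sum>i<b k. ?d (S k i \<omega>)) - (F y - F y')))\<^sup>2) \<partial>M)
      \<le> ennreal ((norm e)\<^sup>2) + ennreal (1 / real (b k)) * (\<integral>\<^sup>+\<xi>. ennreal ((norm (?d \<xi>))\<^sup>2) \<partial>D)"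
  proof (rule nn_expectation_norm_sq_shifted_mean_le)
    show "1 \<le> b k" using batch_sizes by auto
    show "indep_vars (\<lambda>_. borel) (\<lambda>i \<omega>. ?d (S k i \<omega>)) {..<b k}"
      by (rule indep_vars_compose2[OF samples_indep d])
    fix i assume i: "i < b k"
    note law = S_law[OF k i] and [measurable] = S_M[OF i]
    show "integrable M (\<lambda>\<omega>. ?d (S k i \<omega>))"
      using int_d integrable_distr_eq[OF S_M[OF i] d] law by simp
    show "expectation (\<lambda>\<omega>. ?d (S k i \<omega>)) = F y - F y'"
      using mean_d integral_distr[OF S_M[OF i] d] law by simp
    show "(\<integral>\<^sup>+\<omega>. ennreal ((norm (?d (S k i \<omega>)))\<^sup>2) \<partial>M) = (\<integral>\<^sup>+\<xi>. ennreal ((norm (?d \<xi>))\<^sup>2) \<partial>D)"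
      using nn_integral_distr[OF S_M[OF i], of "\<lambda>\<xi>. ennreal ((norm (?d \<xi>))\<^sup>2)"] law by simp
  qed
  then show ?thesis
    unfolding batch_mean_def by (simp add: sum_subtractf scaleR_diff_right)
qed

text \<open>
  The past enters through \<open>\<omega>\<close> and the mega-batch through an independent copy \<open>\<omega>'\<close>; on the
  diagonal this is \<open>Fbar k\<close>.
\<close>

definition frozen_Fbar :: "nat \<Rightarrow> 'w \<Rightarrow> 'w \<Rightarrow> real ^ 'p" where
  "frozen_Fbar k \<omega> \<omega>' = (if full k then F (x k \<omega>) else batch_mean BF (n k) (\<lambda>i. Z k i \<omega>') (x k \<omega>))"

lemma measurable_frozen_Fbar:
  "(\<lambda>z. frozen_Fbar k (fst z) (snd z)) \<in> borel_measurable (Fil k \<Otimes>\<^sub>M fresh_algebra k)"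
proof -
  have x: "(\<lambda>z. x k (fst z)) \<in> borel_measurable (Fil k \<Otimes>\<^sub>M fresh_algebra k)"
    by (rule measurable_compose[OF measurable_fst iterate_measurable])
  have "(\<lambda>z. batch_mean BF (n k) (\<lambda>i. Z k i (snd z)) (x k (fst z))) \<in> borel_measurable (Fil k \<Otimes>\<^sub>M fresh_algebra k)"
    by (rule measurable_batch_mean[OF x])
      (rule measurable_compose[OF measurable_snd batches_sub_fresh[OF Z_batches_measurable]])
  then show ?thesis
    unfolding frozen_Fbar_def using measurable_compose[OF x measurable_F] by (cases "full k") simp_all
qed

lemma cond_exp_Fbar_error:
  "AE \<omega> in M. cond_E M Fil k (\<lambda>\<omega>. (norm (Fbar k \<omega> - F (x k \<omega>)))\<^sup>2) \<omega>
      = (\<integral>\<^sup>+\<omega>'. ennreal ((norm (frozen_Fbar k \<omega> \<omega>' - F (x k \<omega>)))\<^sup>2) \<partial>M)"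
proof -
  interpret finite_measure_subalgebra M "Fil k" by standard (rule Fil_subalgebra)
  note [measurable] = measurable_frozen_Fbar[of k] iterate_measurable[of k]
    measurable_Fil_imp_M[OF Fbar_adapted[of k]] measurable_Fil_imp_M[OF iterate_measurable[of k]]
  let ?h = "\<lambda>z. ennreal ((norm (frozen_Fbar k (fst z) (snd z) - F (x k (fst z))))\<^sup>2)"
  have "?h \<in> borel_measurable (Fil k \<Otimes>\<^sub>M fresh_algebra k)"
    by measurable
  from nn_cond_exp_frozen[OF Fil_subalgebra fresh_subalgebra past_indep_fresh this]
  have frozen: "AE \<omega> in M. nn_cond_exp M (Fil k) (\<lambda>\<omega>. ?h (\<omega>, \<omega>)) \<omega> = (\<integral>\<^sup>+\<omega>'. ?h (\<omega>, \<omega>') \<partial>M)" .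
  have eq: "?h (\<omega>, \<omega>) = ennreal ((norm (Fbar k \<omega> - F (x k \<omega>)))\<^sup>2)" if "\<omega> \<in> space M" for \<omega>
    using that by (simp add: Fbar_eq frozen_Fbar_def)
  have m: "(\<lambda>\<omega>. ennreal ((norm (Fbar k \<omega> - F (x k \<omega>)))\<^sup>2)) \<in> borel_measurable M"
    by measurable
  have m': "(\<lambda>\<omega>. ?h (\<omega>, \<omega>)) \<in> borel_measurable M"
    using m by (rule measurable_cong[THEN iffD1, rotated]) (simp only: eq)
  have "AE \<omega> in M. nn_cond_exp M (Fil k) (\<lambda>\<omega>. ?h (\<omega>, \<omega>)) \<omega>
      = cond_E M Fil k (\<lambda>\<omega>. (norm (Fbar k \<omega> - F (x k \<omega>)))\<^sup>2) \<omega>"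
    by (rule nn_cond_exp_cong[OF AE_I2 m' m]) (rule eq)
  then show ?thesis using frozen by auto
qed

lemma frozen_Fbar_error_le:
  "(\<integral>\<^sup>+\<omega>'. ennreal ((norm (frozen_Fbar k \<omega> \<omega>' - F (x k \<omega>)))\<^sup>2) \<partial>M)
      \<le> (if full k then 0 else ennreal (\<sigma>\<^sup>2 / real (n k)))"
  using mega_variance[of k "x k \<omega>"] by (simp add: frozen_Fbar_def)

text \<open>
  Conditioning on the past fixes the two iterates and the previous error; the integral over the
  fresh copy \<open>\<omega>'\<close> then splits along the coin. The restart branch is again a conditional
  expectation, by \<open>cond_exp_Fbar_error\<close>, and the recursive branch is \<open>batch_error_bound\<close>.
\<close>

lemma cond_exp_err_step:
  assumes k: "1 \<le> k"
  shows "AE \<omega> in M. cond_E M Fil k (\<lambda>\<omega>. (norm (err k \<omega>))\<^sup>2) \<omega>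
      \<le> ennreal ((1 - p k) * (norm (err (k - 1) \<omega>))\<^sup>2)
        + ennreal (p k) * cond_E M Fil k (\<lambda>\<omega>. (norm (Fbar k \<omega> - F (x k \<omega>)))\<^sup>2) \<omega>
        + ennreal ((1 - p k) / real (b k)) * Ebar D BF x k \<omega>"
proof -
  interpret finite_measure_subalgebra M "Fil k" by standard (rule Fil_subalgebra)
  obtain j where j: "k = Suc j" using k by (cases k) auto
  have p: "0 < p k" "p k < 1" using p_range[of k] p_low_pos by auto
  let ?P = "Fil k \<Otimes>\<^sub>M fresh_algebra k"
  define mega where "mega \<omega> \<omega>' = frozen_Fbar k \<omega> \<omega>' - F (x k \<omega>)" for \<omega> \<omega>'
  define batch where "batch \<omega> \<omega>' = err j \<omega>
      + (batch_mean BF (b k) (\<lambda>i. S k i \<omega>') (x k \<omega>) - batch_mean BF (b k) (\<lambda>i. S k i \<omega>') (x j \<omega>))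
      - (F (x k \<omega>) - F (x j \<omega>))" for \<omega> \<omega>'
  \<comment> \<open>On the diagonal, \<open>h\<close> is the squared error after iteration \<open>k\<close>; off it, the past and the draws are decoupled.\<close>
  define h where "h z = (if coin k (snd z) then ennreal ((norm (mega (fst z) (snd z)))\<^sup>2)
      else ennreal ((norm (batch (fst z) (snd z)))\<^sup>2))" for z
  have xj: "x j \<in> borel_measurable (Fil k)" and ej: "err j \<in> borel_measurable (Fil k)"
    unfolding j using measurable_Fil_Suc[OF iterate_measurable] err_adapted by auto
  have xP: "(\<lambda>z. x k (fst z)) \<in> borel_measurable ?P" "(\<lambda>z. x j (fst z)) \<in> borel_measurable ?P"
    by (rule measurable_compose[OF measurable_fst], rule iterate_measurable xj)+
  have SP: "(\<lambda>z. S k i (snd z)) \<in> measurable ?P D" if "i < b k" for i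
    by (rule measurable_compose[OF measurable_snd batches_sub_fresh[OF S_batches_measurable[OF that]]])
  have megaP: "(\<lambda>z. mega (fst z) (snd z)) \<in> borel_measurable ?P"
    unfolding mega_def using measurable_frozen_Fbar measurable_compose[OF xP(1) measurable_F] by measurable
  have batchP: "(\<lambda>z. batch (fst z) (snd z)) \<in> borel_measurable ?P"
    unfolding batch_def
    using measurable_batch_mean[OF xP(1) SP, where m = "b k"] measurable_batch_mean[OF xP(2) SP, where m = "b k"]
      measurable_compose[OF xP(1) measurable_F] measurable_compose[OF xP(2) measurable_F]
      measurable_compose[OF measurable_fst ej]
    by measurable
  have hP: "h \<in> borel_measurable ?P"
    unfolding h_def[abs_def]
    using megaP batchP measurable_compose[OF measurable_snd coin_fresh_measurable] by measurable
  have h_diag: "h (\<omega>, \<omega>) = ennreal ((norm (err k \<omega>))\<^sup>2)" if "\<omega> \<in> space M" for \<omega>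
    using that unfolding h_def err_def mega_def batch_def j
    by (simp add: Ft_Suc Fbar_eq frozen_Fbar_def algebra_simps)
  have m: "(\<lambda>\<omega>. ennreal ((norm (err k \<omega>))\<^sup>2)) \<in> borel_measurable M"
    using measurable_Fil_imp_M[OF err_adapted] by measurable
  have m': "(\<lambda>\<omega>. h (\<omega>, \<omega>)) \<in> borel_measurable M"
    using m by (rule measurable_cong[THEN iffD1, rotated]) (simp only: h_diag)
  have same: "AE \<omega> in M. nn_cond_exp M (Fil k) (\<lambda>\<omega>. h (\<omega>, \<omega>)) \<omega> = cond_E M Fil k (\<lambda>\<omega>. (norm (err k \<omega>))\<^sup>2) \<omega>"
    by (rule nn_cond_exp_cong[OF AE_I2 m' m]) (rule h_diag)
  have bound: "(\<integral>\<^sup>+\<omega>'. h (\<omega>, \<omega>') \<partial>M)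
      \<le> ennreal ((1 - p k) * (norm (err j \<omega>))\<^sup>2)
        + ennreal (p k) * (\<integral>\<^sup>+\<omega>'. ennreal ((norm (mega \<omega> \<omega>'))\<^sup>2) \<partial>M)
        + ennreal ((1 - p k) / real (b k)) * Ebar D BF x k \<omega>" for \<omega>
  proof -
    have Zm: "(\<lambda>\<omega>'. batch_mean BF (n k) (\<lambda>i. Z k i \<omega>') y) \<in> borel_measurable (batches_algebra k)" for y
      by (rule measurable_batch_mean[OF measurable_const Z_batches_measurable]) auto
    have Sm: "(\<lambda>\<omega>'. batch_mean BF (b k) (\<lambda>i. S k i \<omega>') y) \<in> borel_measurable (batches_algebra k)" for y
      by (rule measurable_batch_mean[OF measurable_const S_batches_measurable]) auto
    have A: "(\<lambda>\<omega>'. ennreal ((norm (mega \<omega> \<omega>'))\<^sup>2)) \<in> borel_measurable (batches_algebra k)"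
      unfolding mega_def frozen_Fbar_def using Zm[of "x k \<omega>"] by (cases "full k") simp_all
    have B: "(\<lambda>\<omega>'. ennreal ((norm (batch \<omega> \<omega>'))\<^sup>2)) \<in> borel_measurable (batches_algebra k)"
      unfolding batch_def using Sm[of "x k \<omega>"] Sm[of "x j \<omega>"] by measurable
    have "(\<integral>\<^sup>+\<omega>'. h (\<omega>, \<omega>') \<partial>M) = ennreal (p k) * (\<integral>\<^sup>+\<omega>'. ennreal ((norm (mega \<omega> \<omega>'))\<^sup>2) \<partial>M)
        + ennreal (1 - p k) * (\<integral>\<^sup>+\<omega>'. ennreal ((norm (batch \<omega> \<omega>'))\<^sup>2) \<partial>M)"
      unfolding h_def fst_conv snd_conv by (rule nn_integral_coin_split[OF k A B])
    also have "\<dots> \<le> ennreal (p k) * (\<integral>\<^sup>+\<omega>'. ennreal ((norm (mega \<omega> \<omega>'))\<^sup>2) \<partial>M)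
        + ennreal (1 - p k) * (ennreal ((norm (err j \<omega>))\<^sup>2) + ennreal (1 / real (b k)) * Ebar D BF x k \<omega>)"
      unfolding batch_def Ebar_def using batch_error_bound[OF k, of "err j \<omega>" "x k \<omega>" "x j \<omega>"] j
      by (intro add_left_mono mult_left_mono) simp_all
    also have "\<dots> = ennreal ((1 - p k) * (norm (err j \<omega>))\<^sup>2)
        + ennreal (p k) * (\<integral>\<^sup>+\<omega>'. ennreal ((norm (mega \<omega> \<omega>'))\<^sup>2) \<partial>M)
        + ennreal ((1 - p k) / real (b k)) * Ebar D BF x k \<omega>"
    proof -
      have "ennreal ((1 - p k) / real (b k)) = ennreal (1 - p k) * ennreal (1 / real (b k))"
        using p by (simp flip: ennreal_mult')
      moreover have "ennreal ((1 - p k) * (norm (err j \<omega>))\<^sup>2) = ennreal (1 - p k) * ennreal ((norm (err j \<omega>))\<^sup>2)"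
        using p by (simp add: ennreal_mult')
      ultimately show ?thesis by (simp add: distrib_left ac_simps)
    qed
    finally show ?thesis .
  qed
  from same nn_cond_exp_frozen[OF Fil_subalgebra fresh_subalgebra past_indep_fresh hP] cond_exp_Fbar_error[of k]
  show ?thesis
  proof eventually_elim
    case (elim \<omega>)
    then show ?case using bound[of \<omega>] by (simp add: mega_def j)
  qed
qed

text \<open>
  There is no coin at the start, so the mega-batch error enters with the weight \<open>1\<close>
  instead of \<open>p 0\<close>.
\<close>

lemma cond_exp_err_initial:
  "AE \<omega> in M. cond_E M Fil 0 (\<lambda>\<omega>. (norm (err 0 \<omega>))\<^sup>2) \<omega> \<le> (if full 0 then 0 else ennreal (\<sigma>\<^sup>2 / real (n 0)))"
proof -
  interpret finite_measure_subalgebra M "Fil 0" by standard (rule Fil_subalgebra)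
  note [measurable] = measurable_Fil_imp_M[OF Fbar_adapted[of 0]] measurable_Fil_imp_M[OF iterate_measurable[of 0]]
    measurable_Fil_imp_M[OF err_adapted[of 0]]
  have "AE \<omega> in M. cond_E M Fil 0 (\<lambda>\<omega>. (norm (err 0 \<omega>))\<^sup>2) \<omega>
      = cond_E M Fil 0 (\<lambda>\<omega>. (norm (Fbar 0 \<omega> - F (x 0 \<omega>)))\<^sup>2) \<omega>"
  proof (rule nn_cond_exp_cong)
    show "AE \<omega> in M. ennreal ((norm (err 0 \<omega>))\<^sup>2) = ennreal ((norm (Fbar 0 \<omega> - F (x 0 \<omega>)))\<^sup>2)"
      by (rule AE_I2) (simp add: err_def Ft_0)
  qed measurable
  with cond_exp_Fbar_error[of 0] show ?thesis
    by eventually_elim (use frozen_Fbar_error_le[of 0] in simp)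
qed

text \<open>
  For both choices of the variance parameter the property reduces to \<open>\<tau>\<close> dominating the error
  of the restart, which vanishes for a full batch. The factor \<open>1 - p k\<close> in front of \<open>Ebar\<close>
  is bounded by \<open>1\<close>.
\<close>

lemma VR_property_generic:
  assumes \<tau>: "\<And>k. 0 \<le> \<tau> k"
    and \<tau>_0: "full 0 \<or> \<sigma>\<^sup>2 / real (n 0) \<le> (\<tau> 0)\<^sup>2"
    and \<tau>_step: "\<And>k. 1 \<le> k \<Longrightarrow> full k \<or> p k * (\<sigma>\<^sup>2 / real (n k)) \<le> (\<tau> k)\<^sup>2"
  shows "VR_property M Fil D BF F x Ft (\<lambda>k \<omega>. (norm (Ft k \<omega> - F (x k \<omega>)))\<^sup>2) p (\<lambda>k. 1 / real (b k)) \<tau>"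
  unfolding VR_property_def err_def[symmetric]
proof (intro conjI allI)
  fix k
  show "0 < p k" "p k \<le> 1" using p_range[of k] p_low_pos by auto
  show "0 \<le> \<tau> k" by (rule \<tau>)
  show "err k \<in> borel_measurable M" "(\<lambda>\<omega>. (norm (err k \<omega>))\<^sup>2) \<in> borel_measurable M"
    using measurable_Fil_imp_M[OF err_adapted] by measurable
next
  have "AE \<omega> in M. cond_E M Fil k (\<lambda>\<omega>. (norm (err k \<omega>))\<^sup>2) \<omega>
      \<le> ennreal ((1 - p k) * (if k = 0 then 0 else (norm (err (k - 1) \<omega>))\<^sup>2))
             + ennreal (1 / real (b k)) * Ebar D BF x k \<omega> + ennreal ((\<tau> k)\<^sup>2)" for k
  proof (cases "k = 0")
    case True
    from cond_exp_err_initial show ?thesis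
    proof eventually_elim
      case (elim \<omega>)
      also have "(if full 0 then 0 else ennreal (\<sigma>\<^sup>2 / real (n 0))) \<le> ennreal ((\<tau> 0)\<^sup>2)"
        using \<tau>_0 by (auto intro: ennreal_leI)
      finally show ?case using True by (simp add: add_increasing)
    qed
  next
    case False
    then have k: "1 \<le> k" by simp
    have p: "0 < p k" "p k < 1" using p_range[of k] p_low_pos by auto
    from cond_exp_err_step[OF k] cond_exp_Fbar_error[of k] show ?thesis
    proof eventually_elim
      case (elim \<omega>)
      note elim(1)
      also have "ennreal (p k) * cond_E M Fil k (\<lambda>\<omega>. (norm (Fbar k \<omega> - F (x k \<omega>)))\<^sup>2) \<omega> \<le> ennreal ((\<tau> k)\<^sup>2)"
      proof -
        have "ennreal (p k) * cond_E M Fil k (\<lambda>\<omega>. (norm (Fbar k \<omega> - F (x k \<omega>)))\<^sup>2) \<omega>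
            \<le> ennreal (p k) * (if full k then 0 else ennreal (\<sigma>\<^sup>2 / real (n k)))"
          unfolding elim(2) by (intro mult_left_mono frozen_Fbar_error_le) simp
        also have "\<dots> = (if full k then 0 else ennreal (p k * (\<sigma>\<^sup>2 / real (n k))))"
          using p by (simp add: ennreal_mult'[symmetric])
        also have "\<dots> \<le> ennreal ((\<tau> k)\<^sup>2)"
          using \<tau>_step[OF k] by (auto intro: ennreal_leI)
        finally show ?thesis .
      qed
      also have "ennreal ((1 - p k) / real (b k)) * Ebar D BF x k \<omega> \<le> ennreal (1 / real (b k)) * Ebar D BF x k \<omega>"
        using p by (intro mult_right_mono ennreal_leI divide_right_mono) auto
      finally show ?case using False by (simp add: ac_simps)
    qed
  qed
  then show "AE \<omega> in M. \<forall>k. cond_E M Fil k (\<lambda>\<omega>. (norm (err k \<omega>))\<^sup>2) \<omega> \<le> cond_E M Fil k (\<lambda>\<omega>. (norm (err k \<omega>))\<^sup>2) \<omega> \<and>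
      cond_E M Fil k (\<lambda>\<omega>. (norm (err k \<omega>))\<^sup>2) \<omega>
      \<le> ennreal ((1 - p k) * (if k = 0 then 0 else (norm (err (k - 1) \<omega>))\<^sup>2))
             + ennreal (1 / real (b k)) * Ebar D BF x k \<omega> + ennreal ((\<tau> k)\<^sup>2)"
    by (simp add: AE_all_countable)
qed auto

end

theorem lemma7:
  fixes M :: "'w measure"
    and Fil :: "nat \<Rightarrow> 'w measure"
    and D :: "'s measure"
    and BF :: "real ^ 'p \<Rightarrow> 's \<Rightarrow> real ^ 'p"
    and F :: "real ^ 'p \<Rightarrow> real ^ 'p"
    and \<sigma> p_low :: real
    and x Fbar Ft :: "nat \<Rightarrow> 'w \<Rightarrow> real ^ 'p"
    and p :: "nat \<Rightarrow> real"
    and b n :: "nat \<Rightarrow> nat"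
    and full :: "nat \<Rightarrow> bool"
    and coin :: "nat \<Rightarrow> 'w \<Rightarrow> bool"
    and S Z :: "nat \<Rightarrow> nat \<Rightarrow> 'w \<Rightarrow> 's"
  assumes "l_sarah M Fil D BF F \<sigma> x p_low p b n full coin S Z Fbar Ft"
  shows "(AE \<omega> in M. \<forall>k\<ge>1.
            cond_E M Fil k (\<lambda>\<omega>. (norm (Ft k \<omega> - F (x k \<omega>)))\<^sup>2) \<omega>
              \<le> ennreal ((1 - p k) * (norm (Ft (k - 1) \<omega> - F (x (k - 1) \<omega>)))\<^sup>2)
                 + ennreal (p k) * cond_E M Fil k (\<lambda>\<omega>. (norm (Fbar k \<omega> - F (x k \<omega>)))\<^sup>2) \<omega>
                 + ennreal ((1 - p k) / real (b k)) * Ebar D BF x k \<omega>) \<and>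
         VR_property M Fil D BF F x Ft (\<lambda>k \<omega>. (norm (Ft k \<omega> - F (x k \<omega>)))\<^sup>2)
           p (\<lambda>k. 1 / real (b k)) (lsarah_sigma \<sigma> p n full) \<and>
         ((\<forall>k. full k) \<longrightarrow>
           VR_property M Fil D BF F x Ft (\<lambda>k \<omega>. (norm (Ft k \<omega> - F (x k \<omega>)))\<^sup>2)
             p (\<lambda>k. 1 / real (b k)) (\<lambda>k. 0))"
proof -
  interpret l_sarah M Fil D BF F \<sigma> x p_low p b n full coin S Z Fbar Ft by (rule assms)
  have p: "0 \<le> p k" for k using p_range[of k] p_low_pos by simp
  show ?thesis
  proof (intro conjI impI)
    show "AE \<omega> in M. \<forall>k\<ge>1.
            cond_E M Fil k (\<lambda>\<omega>. (norm (Ft k \<omega> - F (x k \<omega>)))\<^sup>2) \<omega>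
              \<le> ennreal ((1 - p k) * (norm (Ft (k - 1) \<omega> - F (x (k - 1) \<omega>)))\<^sup>2)
                 + ennreal (p k) * cond_E M Fil k (\<lambda>\<omega>. (norm (Fbar k \<omega> - F (x k \<omega>)))\<^sup>2) \<omega>
                 + ennreal ((1 - p k) / real (b k)) * Ebar D BF x k \<omega>"
      unfolding AE_all_countable
      using cond_exp_err_step unfolding err_def by (auto intro: AE_impI)
    show "VR_property M Fil D BF F x Ft (\<lambda>k \<omega>. (norm (Ft k \<omega> - F (x k \<omega>)))\<^sup>2)
           p (\<lambda>k. 1 / real (b k)) (lsarah_sigma \<sigma> p n full)"
      by (rule VR_property_generic) (auto simp: lsarah_sigma_def p)
    show "VR_property M Fil D BF F x Ft (\<lambda>k \<omega>. (norm (Ft k \<omega> - F (x k \<omega>)))\<^sup>2)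
             p (\<lambda>k. 1 / real (b k)) (\<lambda>k. 0)" if "\<forall>k. full k"
      by (rule VR_property_generic) (use that in auto)
  qed
qed

end
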